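(* Let $(X_n)$, $(V_n)$ and $(C_n)$ be sequences of nonnegative integrable real-valued random variables adapted to a filtration $(\mathcal{F}_n)$, and let $(a_n)$, $(u_n)$ be sequences of nonnegative reals. Suppose that \[ \mathbb{E}[X_{n+1}\mid\mathcal{F}_n]\leq (1+a_n)X_n-u_nV_n+C_n\quad\text{a.s.} \] for all $n\in\mathbb{N}$. Also, suppose that there exist $K,L,M>0$ satisfying $\mathbb{E}[X_0]<L$, $\prod_{i=0}^\infty(1+a_i)<K$ and $\sum_{i=0}^\infty \mathbb{E}[C_i]<M$, along with $\chi:(0,\infty)\to \mathbb{N}$ and $\theta:\mathbb{N}\times (0,\infty)\to \mathbb{N}$ such that $\sum_{i=k}^{\theta(k,b)} u_i\geq b$ for all $b>0$ and $k\in\mathbb{N}$, as well as $\sum_{i=\chi(\varepsilon)}^\infty \mathbb{E}[C_i]<\varepsilon$ for all $\varepsilon>0$. Finally, suppose that $\tau:(0,\infty)\to (0,\infty)$ satisfies \[ \forall \varepsilon>0\ \forall n\in\mathbb{N}\ \left(\mathbb{E}[V_n]<\tau(\varepsilon)\to \mathbb{E}[f(X_n)]<\varepsilon\right) \] for some s.i.c.c. function $f:[0,\infty)\to [0,\infty)$ with moduli $\psi$ and $\kappa$. Then $\mathbb{E}[f(X_n)]\to 0$ with rate \[ \rho(\varepsilon):=\theta\left(\chi\left(\kappa\left(\varepsilon'\right)\right),\frac{K(L+M)}{\tau(\varepsilon')}\right) \quad \text{for} \quad \varepsilon':=\frac{\varepsilon\,\psi(K^{-1})}{2}, \] and $X_n\to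 0$ a.s. with rate $\rho'(\lambda,\varepsilon):=\rho(\lambda f(\varepsilon))$.
   Context: All random variables live on a fixed probability space $(\Omega,\mathcal{F},\mathbb{P})$. A function $f:[0,\infty)\to[0,\infty)$ is called s.i.c.c. with moduli $\psi:[0,1]\to[0,1]$ and $\kappa:(0,\infty)\to(0,\infty)$ if: (1) $f$ is $\psi$-supermultiplicative, i.e. $f(xa)\ge f(x)\psi(a)$ for all $x\in[0,\infty)$ and $a\in[0,1]$, where $\psi(x)>0$ for $x>0$; (2) $f$ is strictly increasing; (3) $f$ is concave; (4) $f$ is continuous with $f(0)=0$, and $\kappa$ is a modulus of continuity at $0$, i.e. $x<\kappa(\varepsilon)$ implies $f(x)<\varepsilon$ for all $x\in[0,\infty)$ and $\varepsilon>0$. Rates: "$\mathbb{E}[Y_n]\to0$ with rate $\rho$" (for nonnegative $Y_n$) means $\forall\varepsilon>0\ \forall n\ge\rho(\varepsilon)\ (\mathbb{E}[Y_n]<\varepsilon)$. "$X_n\to0$ a.s. with rate $\rho'$" (for nonnegative $X_n$) means $\forall\lambda,\varepsilon>0\ \left(\mathbb{P}(\exists n\ge\rho'(\lambda,\varepsilon)\ (X_n\ge\varepsilon))<\lambda\right)$. *)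

theory Defs
  imports "HOL-Probability.Probability"
begin

text \<open>A function on \<open>[0,\<infinity>)\<close>, \<open>[0,1]\<close> or \<open>(0,\<infinity>)\<close> is represented by a total function on the reals whose
  values outside the intended domain are irrelevant; its codomain is imposed on that domain only.\<close>

definition sicc :: "(real \<Rightarrow> real) \<Rightarrow> (real \<Rightarrow> real) \<Rightarrow> (real \<Rightarrow> real) \<Rightarrow> bool" where
  "sicc f \<psi> \<kappa> \<longleftrightarrow>
     f \<in> {0..} \<rightarrow> {0..} \<and> \<psi> \<in> {0..1} \<rightarrow> {0..1} \<and> \<kappa> \<in> {0<..} \<rightarrow> {0<..} \<and>
     (\<forall>x\<ge>0. \<forall>a\<in>{0..1}. f (x * a) \<ge> f x * \<psi> a) \<and> (\<forall>a\<in>{0<..1}. \<psi> a > 0) \<and>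
     strict_mono_on {0..} f \<and>
     concave_on {0..} f \<and>
     continuous_on {0..} f \<and> f 0 = 0 \<and>
     (\<forall>\<epsilon>>0. \<forall>x\<ge>0. x < \<kappa> \<epsilon> \<longrightarrow> f x < \<epsilon>)"

definition adapted :: "(nat \<Rightarrow> 'a measure) \<Rightarrow> (nat \<Rightarrow> 'a \<Rightarrow> real) \<Rightarrow> bool" where
  "adapted F X \<longleftrightarrow> (\<forall>n. X n \<in> borel_measurable (F n))"

definition nonneg_integrable_seq :: "'a measure \<Rightarrow> (nat \<Rightarrow> 'a \<Rightarrow> real) \<Rightarrow> bool" where
  "nonneg_integrable_seq P X \<longleftrightarrow> (\<forall>n. integrable P (X n) \<and> (\<forall>\<omega>\<in>space P. X n \<omega> \<ge> 0))"

text \<open>Both rate notions are meant for nonnegative random variables. The Bochner integral of a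
  non-integrable function is 0, whereas a nonnegative random variable of expectation below
  \<open>\<epsilon>\<close> is integrable; hence the explicit integrability in the first one.\<close>

definition mean_zero_rate :: "'a measure \<Rightarrow> (nat \<Rightarrow> 'a \<Rightarrow> real) \<Rightarrow> (real \<Rightarrow> nat) \<Rightarrow> bool" where
  "mean_zero_rate P Y \<rho> \<longleftrightarrow>
     (\<forall>\<epsilon>>0. \<forall>n\<ge>\<rho> \<epsilon>. integrable P (Y n) \<and> (\<integral>\<omega>. Y n \<omega> \<partial>P) < \<epsilon>)"

definition as_zero_rate :: "'a measure \<Rightarrow> (nat \<Rightarrow> 'a \<Rightarrow> real) \<Rightarrow> (real \<Rightarrow> real \<Rightarrow> nat) \<Rightarrow> bool" where
  "as_zero_rate P X \<rho> \<longleftrightarrow>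
     (\<forall>l>0. \<forall>\<epsilon>>0. \<P>(\<omega> in P. \<exists>n\<ge>\<rho> l \<epsilon>. X n \<omega> \<ge> \<epsilon>) < l)"

end

theory Submission
  imports Defs
begin

text \<open>Taking expectations in the recursion bounds \<open>\<Sum>i. u i * E[V i]\<close> by \<open>K * (L + M)\<close>, so on the window
  starting at \<open>k = chi (\<kappa> \<epsilon>')\<close> and ending at the rate some \<open>m\<close> has \<open>E[V m] < \<tau> \<epsilon>'\<close>, whence
  \<open>E[f (X m)] < \<epsilon>'\<close>. From time \<open>m\<close> on, up to a horizon \<open>N\<close>, dividing \<open>X n\<close> by the partial products
  of \<open>1 + a i\<close> and adding the conditional expectation of the remaining \<open>C i\<close> gives a supermartingale
  \<open>W\<close>. By concavity and monotonicity \<open>f (W n)\<close> is again a supermartingale; it starts below \<open>2 * \<epsilon>'\<close> and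
  dominates \<open>\<psi> (1 / K) * f (X n)\<close>, so both rates follow from monotonicity of its means and from
  Ville's maximal inequality, with bounds that do not depend on \<open>N\<close>.\<close>

section \<open>Concave functions on the half-line and a deterministic recursion\<close>

text \<open>Both \<open>x\<close> and \<open>y\<close> are convex combinations of 0 and
  \<open>x + y\<close>. As \<open>f 0 = 0\<close>, concavity bounds \<open>f x\<close> and
  \<open>f y\<close> below by the matching fractions of \<open>f (x + y)\<close>, and these
  fractions add up to 1.\<close>

lemma concave_on_nonneg_subadditive:
  fixes f :: "real \<Rightarrow> real"
  assumes f: "concave_on {0..} f" "f 0 = 0" and xy: "x \<ge> 0" "y \<ge> 0"
  shows "f (x + y) \<le> f x + f y"
proof (cases "x + y = 0")
  case True
  with xy have "x = 0" "y = 0" by linarith+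
  then show ?thesis using f by simp
next
  case False
  then have pos: "x + y > 0" using xy by simp
  have scale: "z / (x + y) * f (x + y) \<le> f z" if "0 \<le> z" "z \<le> x + y" for z
  proof -
    have "f ((1 - z / (x + y)) *\<^sub>R 0 + (z / (x + y)) *\<^sub>R (x + y))
        \<ge> (1 - z / (x + y)) * f 0 + z / (x + y) * f (x + y)"
      using f(1) that pos by (intro concave_onD) auto
    then show ?thesis using pos f(2) by simp
  qed
  have "f (x + y) = x / (x + y) * f (x + y) + y / (x + y) * f (x + y)"
  proof -
    have "x / (x + y) + y / (x + y) = 1" using pos by (simp flip: add_divide_distrib)
    then show ?thesis by (metis distrib_right mult_1)
  qed
  then show ?thesis using scale[of x] scale[of y] xy by linarith
qed

text \<open>Monotonicity settles \<open>x \<le> 1\<close>. For larger \<open>x\<close>, the point 1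
  is a convex combination of 0 and \<open>x\<close>, so \<open>f x \<le> f 1 * x\<close>. The affine
  bound serves to make \<open>f\<close> of an integrable variable integrable.\<close>

lemma concave_on_mono_linear_bound:
  fixes f :: "real \<Rightarrow> real"
  assumes f: "concave_on {0..} f" "f 0 = 0" "mono_on {0..} f" and x: "x \<ge> 0"
  shows "f x \<le> f 1 + f 1 * x"
proof -
  have f1: "f 1 \<ge> 0" using mono_onD[OF f(3), of 0 1] f(2) by simp
  show ?thesis
  proof (cases "x \<le> 1")
    case True
    have "f x \<le> f 1" using mono_onD[OF f(3), of x 1] x True by simp
    moreover have "0 \<le> f 1 * x" using f1 x by simp
    ultimately show ?thesis by simp
  next
    case False
    have "f ((1 - 1 / x) *\<^sub>R 0 + (1 / x) *\<^sub>R x) \<ge> (1 - 1 / x) * f 0 + 1 / x * f x"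
      using f(1) False by (intro concave_onD) auto
    then have "f x \<le> f 1 * x" using False f(2) by (simp add: field_simps)
    then show ?thesis using f1 by simp
  qed
qed

text \<open>The loss already collected can stay on the left-hand side: multiplying it by
  \<open>1 + a n \<ge> 1\<close> only increases it, so it passes through the recursion together with
  \<open>x n\<close>. In the same way \<open>c n\<close> is at most its multiple by the partial
  product.\<close>

lemma summed_gronwall_with_loss:
  fixes x v c a u :: "nat \<Rightarrow> real"
  assumes step: "\<And>n. x (Suc n) \<le> (1 + a n) * x n - u n * v n + c n"
    and nn: "\<And>n. a n \<ge> 0" "\<And>n. u n \<ge> 0" "\<And>n. v n \<ge> 0" "\<And>n. c n \<ge> 0"
  shows "x n + (\<Sum>i<n. u i * v i) \<le> (\<Prod>i<n. 1 + a i) * (x 0 + (\<Sum>i<n. c i))"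
proof (induction n)
  case 0
  then show ?case by simp
next
  case (Suc n)
  let ?S = "\<Sum>i<n. u i * v i" and ?A = "\<Prod>i<n. 1 + a i"
  have S: "0 \<le> ?S" using nn by (intro sum_nonneg) simp
  have A: "1 \<le> (\<Prod>i<Suc n. 1 + a i)" using nn by (intro prod_ge_1) simp
  have "x (Suc n) + (\<Sum>i<Suc n. u i * v i) \<le> (1 + a n) * x n + ?S + c n"
    using step[of n] by simp
  also have "\<dots> \<le> (1 + a n) * (x n + ?S) + c n"
    using S nn(1)[of n] by (simp add: algebra_simps)
  also have "\<dots> \<le> (1 + a n) * (?A * (x 0 + (\<Sum>i<n. c i))) + c n"
    using Suc nn(1)[of n] by (intro add_right_mono mult_left_mono) auto
  also have "\<dots> \<le> (1 + a n) * (?A * (x 0 + (\<Sum>i<n. c i))) + (\<Prod>i<Suc n. 1 + a i) * c n"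
    using mult_right_mono[OF A nn(4)[of n]] by simp
  also have "\<dots> = (\<Prod>i<Suc n. 1 + a i) * (x 0 + (\<Sum>i<Suc n. c i))"
    by (simp add: algebra_simps)
  finally show ?case .
qed

lemma siccD:
  assumes "sicc f \<psi> \<kappa>"
  shows "concave_on {0..} f" and "continuous_on {0..} f" and "f 0 = 0"
    and "strict_mono_on {0..} f" and "mono_on {0..} f" and "x \<ge> 0 \<Longrightarrow> 0 \<le> f x"
    and "\<lbrakk>x \<ge> 0; b \<in> {0..1}\<rbrakk> \<Longrightarrow> f x * \<psi> b \<le> f (x * b)"
    and "b \<in> {0<..1} \<Longrightarrow> 0 < \<psi> b"
    and "0 < \<epsilon> \<Longrightarrow> 0 < \<kappa> \<epsilon>"
    and "\<lbrakk>0 < \<epsilon>; 0 \<le> x; x < \<kappa> \<epsilon>\<rbrakk> \<Longrightarrow> f x < \<epsilon>"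
proof -
  have f: "f \<in> {0..} \<rightarrow> {0..}" and \<kappa>: "\<kappa> \<in> {0<..} \<rightarrow> {0<..}"
    and super: "\<forall>x\<ge>0. \<forall>a\<in>{0..1}. f (x * a) \<ge> f x * \<psi> a"
    and \<psi>: "\<forall>a\<in>{0<..1}. \<psi> a > 0"
    and modulus: "\<forall>\<epsilon>>0. \<forall>x\<ge>0. x < \<kappa> \<epsilon> \<longrightarrow> f x < \<epsilon>"
    and mono: "strict_mono_on {0..} f"
    and rest: "concave_on {0..} f" "continuous_on {0..} f" "f 0 = 0"
    using assms unfolding sicc_def by - (elim conjE, (intro conjI)?, assumption)+
  show "concave_on {0..} f" "continuous_on {0..} f" "f 0 = 0" "strict_mono_on {0..} f"
    by (fact rest mono)+
  show "mono_on {0..} f" using mono by (rule strict_mono_on_imp_mono_on)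
  show "0 \<le> f x" if "x \<ge> 0" using funcset_mem[OF f, of x] that by simp
  show "f x * \<psi> b \<le> f (x * b)" if "x \<ge> 0" "b \<in> {0..1}" using super that by blast
  show "0 < \<psi> b" if "b \<in> {0<..1}" using \<psi> that by blast
  show "0 < \<kappa> \<epsilon>" if "0 < \<epsilon>" using funcset_mem[OF \<kappa>, of \<epsilon>] that by simp
  show "f x < \<epsilon>" if "0 < \<epsilon>" "0 \<le> x" "x < \<kappa> \<epsilon>" using modulus that by blast
qed

section \<open>Supermartingales up to a finite horizon\<close>

text \<open>As a locale, the setting can be interpreted again for the shifted filtration
  \<open>\<lambda>n. F (m + n)\<close>, which restarts the process at time \<open>m\<close>.\<close>

locale filtered_prob_space = prob_space M for M :: "'a measure" +
  fixes F :: "nat \<Rightarrow> 'a measure"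
  assumes subalgebra_M: "\<And>n. subalgebra M (F n)"
    and subalgebra_F: "\<And>i j. i \<le> j \<Longrightarrow> subalgebra (F j) (F i)"
begin

lemma sigma_finite_subalgebra_F: "sigma_finite_subalgebra M (F n)"
proof -
  interpret finite_measure_subalgebra M "F n"
    by unfold_locales (rule subalgebra_M)
  show ?thesis by unfold_locales
qed

text \<open>The horizon is finite because the process this is applied to contains the sum of the
  \<open>C i\<close> with \<open>i < N\<close>, hence depends on \<open>N\<close> itself.\<close>

definition supermartingale_upto :: "nat \<Rightarrow> (nat \<Rightarrow> 'a \<Rightarrow> real) \<Rightarrow> bool" where
  "supermartingale_upto N G \<longleftrightarrow>
     (\<forall>n\<le>N. G n \<in> borel_measurable (F n) \<and> integrable M (G n)) \<and>
     (\<forall>n<N. AE x in M. real_cond_exp M (F n) (G (Suc n)) x \<le> G n x)"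

text \<open>Over an event known at time \<open>n\<close>, the integral of \<open>G (Suc n)\<close>
  equals that of its conditional expectation, which is almost everywhere at most
  \<open>G n\<close>.\<close>

lemma supermartingale_upto_set_integral_le:
  assumes G: "supermartingale_upto N G" and n: "n < N" and E: "E \<in> sets (F n)"
  shows "(LINT x:E|M. G (Suc n) x) \<le> (LINT x:E|M. G n x)"
proof -
  interpret sigma_finite_subalgebra M "F n" by (rule sigma_finite_subalgebra_F)
  have int: "integrable M (G n)" "integrable M (G (Suc n))"
    and le: "AE x in M. real_cond_exp M (F n) (G (Suc n)) x \<le> G n x"
    using G n by (auto simp: supermartingale_upto_def)
  have EM: "E \<in> sets M" using E subalgebra_M[of n] by (auto simp: subalgebra_def)
  have "(LINT x:E|M. G (Suc n) x) = (LINT x:E|M. real_cond_exp M (F n) (G (Suc n)) x)"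
    by (rule real_cond_exp_intA) (use int E in auto)
  also have "\<dots> \<le> (LINT x:E|M. G n x)"
    unfolding set_lebesgue_integral_def
    using int EM le
    by (intro integral_mono_AE integrable_mult_indicator real_cond_exp_int)
       (auto simp: indicator_def)
  finally show ?thesis .
qed

lemma supermartingale_upto_expectation_le:
  assumes G: "supermartingale_upto N G"
  shows "expectation (G N) \<le> expectation (G 0)"
proof -
  have "n \<le> N \<longrightarrow> expectation (G n) \<le> expectation (G 0)" for n
  proof (induction n)
    case (Suc n)
    have "space M \<in> sets (F n)"
      using subalgebra_M[of n] by (metis sets.top subalgebra_def)
    moreover have "(LINT x:space M|M. h x) = expectation h" for h :: "'a \<Rightarrow> real"
      unfolding set_lebesgue_integral_def by (intro Bochner_Integration.integral_cong) auto
    ultimately have "expectation (G (Suc n)) \<le> expectation (G n)" if "n < N"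
      using supermartingale_upto_set_integral_le[OF G that, of "space M"] by simp
    then show ?case using Suc by force
  qed simp
  then show ?thesis by simp
qed

text \<open>Backward induction on the starting time replaces a stopping time. An event is split
  according to whether \<open>G j\<close> reaches \<open>c\<close>: where it does, Markov's
  inequality applies; where it does not, the induction hypothesis for \<open>Suc j\<close> applies,
  and the supermartingale property leads back to \<open>G j\<close>.\<close>

lemma supermartingale_upto_maximal_ineq:
  assumes G: "supermartingale_upto N G"
    and nonneg: "\<And>n x. n \<le> N \<Longrightarrow> x \<in> space M \<Longrightarrow> 0 \<le> G n x"
  shows "c * prob {x \<in> space M. \<exists>n\<le>N. c \<le> G n x} \<le> expectation (G 0)"
proof -
  have meas: "G n \<in> borel_measurable (F n)" "integrable M (G n)" if "n \<le> N" for n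
    using G that by (auto simp: supermartingale_upto_def)
  have sp: "space (F n) = space M" and sub: "sets (F n) \<subseteq> sets M" for n
    using subalgebra_M[of n] by (auto simp: subalgebra_def)
  have measM [measurable]: "G n \<in> borel_measurable M" if "n \<le> N" for n
    using meas[OF that] by auto
  have level: "c * prob E \<le> (LINT x:E|M. G n x)"
    if "n \<le> N" "E \<in> sets M" "\<And>x. x \<in> E \<Longrightarrow> c \<le> G n x" for n E
  proof -
    have "c * prob E = (\<integral>x. indicator E x *\<^sub>R c \<partial>M)"
      using that(2) by (simp add: mult.commute)
    also have "\<dots> \<le> (LINT x:E|M. G n x)"
      unfolding set_lebesgue_integral_def using that meas
      by (intro integral_mono integrable_mult_indicator) (auto simp: indicator_def)
    finally show ?thesis .
  qed
  \<comment> \<open>The induction needs the inequality localised to every event \<open>E\<close>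
    known at the starting time \<open>j\<close>; the goal is the case of \<open>j = 0\<close> and
    the whole space.\<close>
  have main: "c * prob {x \<in> E. \<exists>n\<in>{j..N}. c \<le> G n x} \<le> (LINT x:E|M. G j x)"
    if "j \<le> N" "E \<in> sets (F j)" for j E
    using that
  proof (induction arbitrary: E rule: inc_induct)
    case base
    have E: "E \<in> sets M" "E \<subseteq> space M"
      using base sub sets.sets_into_space by blast+
    let ?E = "{x \<in> E. c \<le> G N x}"
    have Eset: "?E \<in> sets M"
    proof -
      have "?E = E \<inter> {x \<in> space M. c \<le> G N x}" using E by auto
      also have "\<dots> \<in> sets M" using E measM[of N] by measurable
      finally show ?thesis .
    qed
    have "{x \<in> E. \<exists>n\<in>{N..N}. c \<le> G n x} = ?E" by simp
    moreover have "c * prob ?E \<le> (LINT x:?E|M. G N x)"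
      using Eset by (intro level) auto
    moreover have "(LINT x:?E|M. G N x) \<le> (LINT x:E|M. G N x)"
      unfolding set_lebesgue_integral_def using Eset E meas nonneg
      by (intro integral_mono integrable_mult_indicator) (auto simp: indicator_def)
    ultimately show ?case by simp
  next
    case (step j)
    have jN: "j \<le> N" "Suc j \<le> N" using step by auto
    have E: "E \<in> sets M" "E \<subseteq> space M"
      using step.prems sub sets.sets_into_space by blast+
    let ?E1 = "{x \<in> E. c \<le> G j x}" and ?E2 = "{x \<in> E. \<not> c \<le> G j x}"
    have E12: "?E1 \<in> sets (F j)" "?E2 \<in> sets (F j)"
    proof -
      have Esp: "?E1 = E \<inter> {x \<in> space (F j). c \<le> G j x}" "?E2 = E \<inter> {x \<in> space (F j). \<not> c \<le> G j x}"
        using E sp by auto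
      show "?E1 \<in> sets (F j)" "?E2 \<in> sets (F j)"
        unfolding Esp using step.prems meas(1)[OF jN(1)] by measurable
    qed
    then have E12M: "?E1 \<in> sets M" "?E2 \<in> sets M" using sub by auto
    have "sets (F j) \<subseteq> sets (F (Suc j))"
      using subalgebra_F[of j "Suc j"] by (auto simp: subalgebra_def)
    \<comment> \<open>The induction hypothesis speaks of events known at time \<open>Suc j\<close>;
      the filtration is increasing, so \<open>?E2\<close> is one of them.\<close>
    then have E2': "?E2 \<in> sets (F (Suc j))" using E12 by auto
    let ?T = "{x \<in> ?E2. \<exists>n\<in>{Suc j..N}. c \<le> G n x}"
    have T: "?T \<in> sets M"
    proof -
      have "?T = (\<Union>n\<in>{Suc j..N}. ?E2 \<inter> {x \<in> space M. c \<le> G n x})" using E by auto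
      also have "\<dots> \<in> sets M"
      proof (rule sets.finite_UN)
        fix n assume "n \<in> {Suc j..N}"
        then have [measurable]: "G n \<in> borel_measurable M" using measM by auto
        show "?E2 \<inter> {x \<in> space M. c \<le> G n x} \<in> sets M" using E12M(2) by measurable
      qed simp
      finally show ?thesis .
    qed
    have "{x \<in> E. \<exists>n\<in>{j..N}. c \<le> G n x} = ?E1 \<union> ?T"
      unfolding Icc_eq_insert_lb_nat[OF jN(1)] by auto
    moreover have disj: "?E1 \<inter> ?T = {}" by blast
    ultimately have "c * prob {x \<in> E. \<exists>n\<in>{j..N}. c \<le> G n x} = c * prob ?E1 + c * prob ?T"
      using finite_measure_Union[OF E12M(1) T disj] by (simp add: distrib_left)
    also have "\<dots> \<le> (LINT x:?E1|M. G j x) + (LINT x:?E2|M. G (Suc j) x)"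
      using step.IH[OF E2'] level[OF jN(1) E12M(1)] by (intro add_mono) auto
    also have "\<dots> \<le> (LINT x:?E1|M. G j x) + (LINT x:?E2|M. G j x)"
      using supermartingale_upto_set_integral_le[OF G _ E12(2)] step by simp
    also have "\<dots> = (LINT x:?E1 \<union> ?E2|M. G j x)"
      using meas(2)[OF jN(1)] E12M
      by (intro set_integral_Un[symmetric])
         (auto simp: set_integrable_def simp del: real_scaleR_def intro!: integrable_mult_indicator)
    also have "?E1 \<union> ?E2 = E" by auto
    finally show ?case .
  qed
  have "space M \<in> sets (F 0)"
    using sp[of 0] by (metis sets.top)
  from main[OF _ this] have
    "c * prob {x \<in> space M. \<exists>n\<in>{0..N}. c \<le> G n x} \<le> (LINT x:space M|M. G 0 x)" by simp
  also have "\<dots> = expectation (G 0)"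
    unfolding set_lebesgue_integral_def by (intro Bochner_Integration.integral_cong) auto
  finally show ?thesis by (simp add: Bex_def)
qed

section \<open>Concave transforms and the correction of almost supermartingales\<close>

text \<open>Conditional Jensen for the convex function \<open>-g\<close> moves \<open>g\<close>
  outside the conditional expectation of \<open>W (Suc n)\<close>. Monotonicity of \<open>g\<close>
  then carries the supermartingale inequality for \<open>W\<close> over to
  \<open>g (W n)\<close>.\<close>

lemma supermartingale_upto_concave:
  assumes W: "supermartingale_upto N W"
    and pos: "\<And>n x. n \<le> N \<Longrightarrow> x \<in> space M \<Longrightarrow> 0 < W n x"
    and g: "concave_on {0<..} g" "mono_on {0<..} g" "g \<in> borel_measurable borel"
    and int: "\<And>n. n \<le> N \<Longrightarrow> integrable M (\<lambda>x. g (W n x))"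
  shows "supermartingale_upto N (\<lambda>n x. g (W n x))"
  unfolding supermartingale_upto_def
proof (intro conjI allI impI)
  fix n assume "n \<le> N"
  then show "(\<lambda>x. g (W n x)) \<in> borel_measurable (F n)" "integrable M (\<lambda>x. g (W n x))"
    using W g(3) int by (auto simp: supermartingale_upto_def intro: measurable_compose)
next
  fix n assume n: "n < N"
  interpret sigma_finite_subalgebra M "F n" by (rule sigma_finite_subalgebra_F)
  have iW: "integrable M (W (Suc n))" and le: "AE x in M. real_cond_exp M (F n) (W (Suc n)) x \<le> W n x"
    using W n by (auto simp: supermartingale_upto_def)
  have ig: "integrable M (\<lambda>x. g (W (Suc n) x))" using int n by simp
  have ae: "AE x in M. W (Suc n) x \<in> {0<..}" using pos n by (intro AE_I2) auto
  note J = real_cond_exp_jensens_inequality[OF iW ae, where q = "\<lambda>x. - g x"]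
  have 1: "AE x in M. real_cond_exp M (F n) (W (Suc n)) x \<in> {0<..}"
    by (rule J(1)) (use ig g in \<open>auto simp: concave_on_def\<close>)
  have 2: "AE x in M. - g (real_cond_exp M (F n) (W (Suc n)) x)
      \<le> real_cond_exp M (F n) (\<lambda>x. - g (W (Suc n) x)) x"
    by (rule J(2)) (use ig g in \<open>auto simp: concave_on_def\<close>)
  have 3: "AE x in M. real_cond_exp M (F n) (\<lambda>x. - g (W (Suc n) x)) x
      = - real_cond_exp M (F n) (\<lambda>x. g (W (Suc n) x)) x"
    using real_cond_exp_cmult[OF ig, of "-1"] by simp
  from 1 2 3 le AE_space[of M]
  show "AE x in M. real_cond_exp M (F n) (\<lambda>x. g (W (Suc n) x)) x \<le> g (W n x)"
  proof eventually_elim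
    case (elim x)
    then have "g (real_cond_exp M (F n) (W (Suc n)) x) \<le> g (W n x)"
      using pos[of n x] n by (intro mono_onD[OF g(2)]) auto
    then show ?case using elim by linarith
  qed
qed

text \<open>The summand \<open>\<eta>\<close> keeps \<open>W\<close> in the open half-line \<open>{0<..}\<close>, as the library's conditional Jensen
  inequality needs an open interval and \<open>f\<close> may be infinitely steep at 0.\<close>

lemma almost_supermartingale_correction:
  fixes X C :: "nat \<Rightarrow> 'a \<Rightarrow> real" and a :: "nat \<Rightarrow> real"
  assumes X: "adapted F X" "nonneg_integrable_seq M X"
    and C: "adapted F C" "nonneg_integrable_seq M C"
    and a: "\<And>n. a n \<ge> 0"
    and step: "\<And>n. AE x in M. real_cond_exp M (F n) (X (Suc n)) x \<le> (1 + a n) * X n x + C n x"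
    and \<eta>: "\<eta> > 0"
  obtains W R where "supermartingale_upto N W"
    and "\<And>n x. x \<in> space M \<Longrightarrow> X n x / (\<Prod>i<n. 1 + a i) + \<eta> \<le> W n x"
    and "\<And>x. W 0 x = X 0 x + R x" and "integrable M R" and "\<And>x. R x \<ge> \<eta>"
    and "expectation R = \<eta> + (\<Sum>i<N. expectation (C i))"
proof -
  define A where "A n = (\<Prod>i<n. 1 + a i)" for n
  have A1: "A n \<ge> 1" for n unfolding A_def using a by (intro prod_ge_1) simp
  have ASuc: "A (Suc n) = A n * (1 + a n)" for n by (simp add: A_def)
  \<comment> \<open>\<open>S n\<close> collects the \<open>C i\<close> still to come before the
    horizon, and \<open>E n\<close> predicts it at time \<open>n\<close>. Passing from
    \<open>n\<close> to \<open>Suc n\<close> releases \<open>C n\<close> from the prediction, which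
    pays for the term \<open>C n\<close> in the recursion.\<close>
  define S where "S n x = (\<Sum>i=n..<N. C i x)" for n x
  define E where "E n = real_cond_exp M (F n) (S n)" for n
  \<comment> \<open>\<open>max 0\<close> changes \<open>E n\<close> on a null set only, and makes
    the lower bound for \<open>W\<close> valid at every point instead of almost everywhere.\<close>
  define W where "W n x = X n x / A n + max 0 (E n x) + \<eta>" for n x
  define R where "R x = max 0 (E 0 x) + \<eta>" for x
  have XF [measurable]: "X n \<in> borel_measurable (F n)" for n
    using X(1) by (simp add: adapted_def)
  have CF: "C n \<in> borel_measurable (F n)" for n using C(1) by (simp add: adapted_def)
  have iX: "integrable M (X n)" and X0: "x \<in> space M \<Longrightarrow> 0 \<le> X n x" for n x
    using X(2) by (auto simp: nonneg_integrable_seq_def)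
  have iC: "integrable M (C n)" and C0: "x \<in> space M \<Longrightarrow> 0 \<le> C n x" for n x
    using C(2) by (auto simp: nonneg_integrable_seq_def)
  have iS: "integrable M (S n)" for n unfolding S_def using iC by auto
  have S0: "x \<in> space M \<Longrightarrow> 0 \<le> S n x" for n x
    unfolding S_def using C0 by (intro sum_nonneg) auto
  have iE: "integrable M (E n)" and E_int: "expectation (E n) = expectation (S n)"
    and E0: "AE x in M. 0 \<le> E n x" for n
  proof -
    interpret sigma_finite_subalgebra M "F n" by (rule sigma_finite_subalgebra_F)
    show "integrable M (E n)" "expectation (E n) = expectation (S n)"
      unfolding E_def using iS by (auto intro: real_cond_exp_int)
    show "AE x in M. 0 \<le> E n x"
      unfolding E_def using S0 iS by (intro real_cond_exp_pos AE_I2) auto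
  qed
  have EF [measurable]: "E n \<in> borel_measurable (F n)" for n unfolding E_def by simp
  have iW: "integrable M (W n)" for n
    unfolding W_def using iX iE by auto
  have WF: "W n \<in> borel_measurable (F n)" for n
    unfolding W_def by measurable
  have super: "AE x in M. real_cond_exp M (F n) (W (Suc n)) x \<le> W n x" if n: "n < N" for n
  proof -
    interpret sigma_finite_subalgebra M "F n" by (rule sigma_finite_subalgebra_F)
    let ?Y = "\<lambda>x. inverse (A (Suc n)) * X (Suc n) x"
    have iY: "integrable M ?Y" using iX by auto
    have WY: "AE x in M. W (Suc n) x = (?Y x + E (Suc n) x) + \<eta>"
      using E0[of "Suc n"] by eventually_elim (simp add: W_def divide_simps)
    have 1: "AE x in M. real_cond_exp M (F n) (W (Suc n)) x
        = real_cond_exp M (F n) (\<lambda>x. (?Y x + E (Suc n) x) + \<eta>) x"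
      using iW iY iE by (intro real_cond_exp_cong[OF WY]) auto
    have 2: "AE x in M. real_cond_exp M (F n) (\<lambda>x. (?Y x + E (Suc n) x) + \<eta>) x
        = real_cond_exp M (F n) (\<lambda>x. ?Y x + E (Suc n) x) x + real_cond_exp M (F n) (\<lambda>x. \<eta>) x"
      using iY iE by (intro real_cond_exp_add) auto
    have 3: "AE x in M. real_cond_exp M (F n) (\<lambda>x. ?Y x + E (Suc n) x) x
        = real_cond_exp M (F n) ?Y x + real_cond_exp M (F n) (E (Suc n)) x"
      using iY iE by (intro real_cond_exp_add) auto
    have 4: "AE x in M. real_cond_exp M (F n) (\<lambda>x. \<eta>) x = \<eta>"
      by (intro real_cond_exp_F_meas) auto
    have 5: "AE x in M. real_cond_exp M (F n) ?Y x = inverse (A (Suc n)) * real_cond_exp M (F n) (X (Suc n)) x"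
      using iX by (intro real_cond_exp_cmult) auto
    have 6: "AE x in M. real_cond_exp M (F n) (E (Suc n)) x = real_cond_exp M (F n) (S (Suc n)) x"
      unfolding E_def using subalgebra_M subalgebra_F iS by (intro real_cond_exp_nested_subalg) auto
    have Seq: "S n = (\<lambda>x. C n x + S (Suc n) x)"
      unfolding S_def using n by (simp add: sum.atLeast_Suc_lessThan fun_eq_iff)
    have 7: "AE x in M. E n x = real_cond_exp M (F n) (C n) x + real_cond_exp M (F n) (S (Suc n)) x"
      unfolding E_def Seq using iC iS by (intro real_cond_exp_add) auto
    have 8: "AE x in M. real_cond_exp M (F n) (C n) x = C n x"
      using iC CF by (intro real_cond_exp_F_meas) auto
    from 1 2 3 4 5 6 7 8 step[of n] AE_space[of M] show ?thesis
    proof eventually_elim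
      case (elim x)
      \<comment> \<open>Dividing by \<open>A (Suc n) = A n * (1 + a n)\<close> cancels the growth
        factor of the recursion. The quotient \<open>C n / A (Suc n)\<close> is at most
        \<open>C n\<close>, the amount that the prediction loses in this step.\<close>
      have "inverse (A (Suc n)) * real_cond_exp M (F n) (X (Suc n)) x
          \<le> inverse (A (Suc n)) * ((1 + a n) * X n x + C n x)"
        using elim(9) A1[of "Suc n"] by (intro mult_left_mono) auto
      also have "\<dots> = (inverse (1 + a n) * (1 + a n)) * (X n x / A n) + C n x / A (Suc n)"
        unfolding ASuc inverse_mult_distrib divide_inverse distrib_left[of "_ * _"] by (simp only: ac_simps)
      also have "inverse (1 + a n) * (1 + a n) = 1"
        using a[of n] by (intro left_inverse) auto
      also have "1 * (X n x / A n) + C n x / A (Suc n) \<le> X n x / A n + C n x"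
        using A1[of "Suc n"] C0[OF elim(10), of n] by (simp add: divide_le_eq mult_le_cancel_left1)
      finally show ?case using elim(1-8) by (simp add: W_def)
    qed
  qed
  show thesis
  proof (rule that[of W R])
    show "supermartingale_upto N W"
      using WF iW super by (simp add: supermartingale_upto_def)
    show "X n x / (\<Prod>i<n. 1 + a i) + \<eta> \<le> W n x" for n x by (simp add: W_def A_def)
    show "W 0 x = X 0 x + R x" "R x \<ge> \<eta>" for x by (simp_all add: W_def R_def A_def)
    show "integrable M R" unfolding R_def using iE by auto
    have "expectation R = expectation (\<lambda>x. E 0 x + \<eta>)"
      unfolding R_def
      by (rule integral_cong_AE) (use E0[of 0] iE in \<open>auto intro: borel_measurable_integrable\<close>)
    also have "\<dots> = expectation (S 0) + \<eta>"
      using iE E_int by (simp add: prob_space)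
    also have "expectation (S 0) = (\<Sum>i<N. expectation (C i))"
      unfolding S_def using iC by (simp add: lessThan_atLeast0)
    finally show "expectation R = \<eta> + (\<Sum>i<N. expectation (C i))" by simp
  qed
qed

text \<open>The affine majorant \<open>f 1 + f 1 * Y\<close> is integrable and dominates
  \<open>f (Y x)\<close>.\<close>

lemma integrable_concave_mono:
  fixes f :: "real \<Rightarrow> real"
  assumes f: "concave_on {0..} f" "f 0 = 0" "mono_on {0..} f" "continuous_on {0..} f"
    and Y: "integrable M Y" "\<And>x. x \<in> space M \<Longrightarrow> 0 \<le> Y x"
  shows "integrable M (\<lambda>x. f (Y x))"
proof -
  \<comment> \<open>\<open>f\<close> is controlled on \<open>{0..}\<close> only; composing with
    \<open>max 0\<close> gives a function that is continuous, hence Borel, on the whole line and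
    agrees with \<open>f\<close> on the values of \<open>Y\<close>.\<close>
  have cont: "continuous_on UNIV (\<lambda>x. f (max 0 x))"
    by (rule continuous_on_compose2[OF f(4)]) (auto intro!: continuous_intros)
  have [measurable]: "(\<lambda>x. f (max 0 x)) \<in> borel_measurable borel"
    using cont by (rule borel_measurable_continuous_onI)
  have [measurable]: "Y \<in> borel_measurable M" using Y by auto
  have "integrable M (\<lambda>x. f (max 0 (Y x)))"
  proof (rule Bochner_Integration.integrable_bound)
    show "integrable M (\<lambda>x. f 1 + f 1 * Y x)" using Y by auto
    show "AE x in M. norm (f (max 0 (Y x))) \<le> norm (f 1 + f 1 * Y x)"
    proof (rule AE_I2)
      fix x assume x: "x \<in> space M"
      have "0 \<le> f (Y x)" using mono_onD[OF f(3), of 0 "Y x"] f(2) Y(2)[OF x] by simp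
      then show "norm (f (max 0 (Y x))) \<le> norm (f 1 + f 1 * Y x)"
        using concave_on_mono_linear_bound[OF f(1-3) Y(2)[OF x]] Y(2)[OF x] by simp
    qed
    have "(\<lambda>x. f (max 0 x)) \<circ> Y \<in> borel_measurable M" by measurable
    then show "(\<lambda>x. f (max 0 (Y x))) \<in> borel_measurable M" by (simp add: comp_def)
  qed
  then show ?thesis using Y(2) by (simp cong: Bochner_Integration.integrable_cong)
qed

text \<open>\<open>G\<close> is \<open>f\<close> applied to the corrected process \<open>W\<close>.
  Supermultiplicativity trades the partial products, all at most \<open>K\<close>, for the factor
  \<open>\<psi> (inverse K)\<close>. Subadditivity separates \<open>X 0\<close> from the correction
  \<open>R\<close>, and Jensen bounds the mean of \<open>f (R x)\<close> by
  \<open>f t\<close>.\<close>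

lemma almost_supermartingale_concave_majorant:
  fixes X C :: "nat \<Rightarrow> 'a \<Rightarrow> real" and a :: "nat \<Rightarrow> real"
  assumes X: "adapted F X" "nonneg_integrable_seq M X"
    and C: "adapted F C" "nonneg_integrable_seq M C"
    and a: "\<And>n. a n \<ge> 0" and K: "\<And>n. (\<Prod>i<n. 1 + a i) \<le> K"
    and step: "\<And>n. AE x in M. real_cond_exp M (F n) (X (Suc n)) x \<le> (1 + a n) * X n x + C n x"
    and f: "sicc f \<psi> \<kappa>" and t: "(\<Sum>i<N. expectation (C i)) < t"
  obtains G where "supermartingale_upto N G"
    and "\<And>n x. x \<in> space M \<Longrightarrow> \<psi> (inverse K) * f (X n x) \<le> G n x"
    and "expectation (G 0) \<le> expectation (\<lambda>x. f (X 0 x)) + f t"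
proof -
  have K1: "K \<ge> 1" using K[of 0] by simp
  note fconc = siccD(1)[OF f] and fcont = siccD(2)[OF f] and f0 = siccD(3)[OF f]
    and fmono = siccD(5)[OF f] and super = siccD(7)[OF f]
  have X0: "x \<in> space M \<Longrightarrow> 0 \<le> X n x" and iX: "integrable M (X n)" for n x
    using X(2) by (auto simp: nonneg_integrable_seq_def)
  \<comment> \<open>The slack in the strict bound \<open>t\<close> is spent on
    \<open>\<eta>\<close>, so that \<open>R\<close> has mean exactly \<open>t\<close>.\<close>
  define \<eta> where "\<eta> = t - (\<Sum>i<N. expectation (C i))"
  have \<eta>: "\<eta> > 0" using t by (simp add: \<eta>_def)
  obtain W R where W: "supermartingale_upto N W"
    and WX: "\<And>n x. x \<in> space M \<Longrightarrow> X n x / (\<Prod>i<n. 1 + a i) + \<eta> \<le> W n x"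
    and W0: "\<And>x. W 0 x = X 0 x + R x" and iR: "integrable M R" and R\<eta>: "\<And>x. R x \<ge> \<eta>"
    and ER: "expectation R = \<eta> + (\<Sum>i<N. expectation (C i))"
    by (rule almost_supermartingale_correction[OF X C a step \<eta>, of N]) (rule that)
  have ERt: "expectation R = t" using ER by (simp add: \<eta>_def)
  have A1: "(\<Prod>i<n. 1 + a i) \<ge> 1" for n using a by (intro prod_ge_1) simp
  have XA0: "0 \<le> X n x / (\<Prod>i<n. 1 + a i)" if "x \<in> space M" for n x
    using X0[OF that, of n] A1[of n] by simp
  have Wpos: "0 < W n x" if "x \<in> space M" for n x
    using WX[OF that, of n] XA0[OF that, of n] \<eta> by linarith
  have iW: "integrable M (W n)" if "n \<le> N" for n
    using W that by (auto simp: supermartingale_upto_def)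
  define g where "g x = f (max 0 x)" for x
  have g: "g x = f x" if "0 \<le> x" for x using that by (simp add: g_def)
  have gconc: "concave_on {0<..} g"
    unfolding concave_on_iff
  proof (intro conjI ballI allI impI)
    fix x y v w :: real
    assume *: "x \<in> {0<..}" "y \<in> {0<..}" "0 \<le> v" "0 \<le> w" "v + w = 1"
    then have "0 \<le> v *\<^sub>R x + w *\<^sub>R y" by simp
    moreover have "v * f x + w * f y \<le> f (v *\<^sub>R x + w *\<^sub>R y)"
      using fconc * unfolding concave_on_iff by auto
    ultimately show "v * g x + w * g y \<le> g (v *\<^sub>R x + w *\<^sub>R y)" using * g by simp
  qed simp
  have gcont: "continuous_on UNIV g"
    unfolding g_def by (rule continuous_on_compose2[OF fcont]) (auto intro!: continuous_intros)
  have gW: "integrable M (\<lambda>x. g (W n x))" if "n \<le> N" for n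
  proof -
    have "integrable M (\<lambda>x. f (W n x))"
      using iW[OF that] Wpos by - (rule integrable_concave_mono[OF fconc f0 fmono fcont], auto intro: less_imp_le)
    moreover have "g (W n x) = f (W n x)" if "x \<in> space M" for x
      using Wpos[OF that, of n] by (intro g) simp
    ultimately show ?thesis by (simp cong: Bochner_Integration.integrable_cong)
  qed
  have ifX: "integrable M (\<lambda>x. f (X 0 x))"
    using iX X0 by (rule integrable_concave_mono[OF fconc f0 fmono fcont]) auto
  have R0: "0 < R x" for x using R\<eta>[of x] \<eta> by linarith
  have ifR: "integrable M (\<lambda>x. f (R x))"
    using iR R0 by - (rule integrable_concave_mono[OF fconc f0 fmono fcont], auto intro: less_imp_le)
  show thesis
  proof (rule that[of "\<lambda>n x. g (W n x)"])
    show "supermartingale_upto N (\<lambda>n x. g (W n x))"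
    proof (rule supermartingale_upto_concave[OF W])
      show "mono_on {0<..} g"
        using fmono by (auto simp: g_def mono_on_def)
      show "g \<in> borel_measurable borel" using gcont by (rule borel_measurable_continuous_onI)
    qed (use Wpos gconc gW in auto)
    show "\<psi> (inverse K) * f (X n x) \<le> g (W n x)" if x: "x \<in> space M" for n x
    proof -
      have "\<psi> (inverse K) * f (X n x) \<le> f (X n x * inverse K)"
        using super[OF X0[OF x], of "inverse K" n] K1 by (simp add: mult.commute inverse_le_1_iff)
      also have "X n x * inverse K \<le> X n x / (\<Prod>i<n. 1 + a i)"
        using K[of n] A1[of n] X0[OF x, of n] unfolding divide_inverse
        by (intro mult_left_mono le_imp_inverse_le) auto
      then have "X n x * inverse K \<le> W n x" using WX[OF x, of n] \<eta> by linarith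
      then have "f (X n x * inverse K) \<le> f (W n x)"
        using X0[OF x, of n] K1 Wpos[OF x, of n] by (intro mono_onD[OF fmono]) auto
      also have "f (W n x) = g (W n x)" using Wpos[OF x, of n] by (intro g[symmetric]) simp
      finally show ?thesis .
    qed
    have "expectation (\<lambda>x. g (W 0 x)) \<le> expectation (\<lambda>x. f (X 0 x) + f (R x))"
    proof (rule integral_mono)
      fix x assume x: "x \<in> space M"
      have "g (W 0 x) = f (X 0 x + R x)" using Wpos[OF x, of 0] W0[of x] by (simp add: g)
      also have "\<dots> \<le> f (X 0 x) + f (R x)"
        using X0[OF x, of 0] R0[of x] by (intro concave_on_nonneg_subadditive fconc f0) auto
      finally show "g (W 0 x) \<le> f (X 0 x) + f (R x)" .
    qed (use gW ifX ifR in auto)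
    also have "\<dots> = expectation (\<lambda>x. f (X 0 x)) + expectation (\<lambda>x. f (R x))"
      using ifX ifR by simp
    also have "expectation (\<lambda>x. f (R x)) \<le> f t"
    proof -
      have "convex_on {0<..} (\<lambda>x. - f x)"
        using fconc unfolding concave_on_def by (rule convex_on_subset) auto
      then have "- f (expectation R) \<le> expectation (\<lambda>x. - f (R x))"
        using iR R0 ifR by (intro jensens_inequality[where I = "{0<..}"]) auto
      then show ?thesis using ERt by simp
    qed
    finally show "expectation (\<lambda>x. g (W 0 x)) \<le> expectation (\<lambda>x. f (X 0 x)) + f t" by simp
  qed
qed

text \<open>For each horizon the majorant yields one bound through its decreasing means and one
  through the maximal inequality. Neither right-hand side depends on the horizon, so the second
  bound extends to all times at once.\<close>

lemma almost_supermartingale_bounds: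
  fixes X C :: "nat \<Rightarrow> 'a \<Rightarrow> real" and a :: "nat \<Rightarrow> real"
  assumes X: "adapted F X" "nonneg_integrable_seq M X"
    and C: "adapted F C" "nonneg_integrable_seq M C"
    and a: "\<And>n. a n \<ge> 0" and K: "\<And>n. (\<Prod>i<n. 1 + a i) \<le> K"
    and step: "\<And>n. AE x in M. real_cond_exp M (F n) (X (Suc n)) x \<le> (1 + a n) * X n x + C n x"
    and f: "sicc f \<psi> \<kappa>" and t: "\<And>N. (\<Sum>i<N. expectation (C i)) < t"
  shows "\<psi> (inverse K) * expectation (\<lambda>x. f (X N x)) \<le> expectation (\<lambda>x. f (X 0 x)) + f t"
    and "\<delta> \<ge> 0 \<Longrightarrow> \<psi> (inverse K) * f \<delta> * prob {x \<in> space M. \<exists>n. \<delta> \<le> X n x}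
           \<le> expectation (\<lambda>x. f (X 0 x)) + f t"
proof -
  have K1: "K \<ge> 1" using K[of 0] by simp
  note fconc = siccD(1)[OF f] and fcont = siccD(2)[OF f] and f0 = siccD(3)[OF f]
    and fmono = siccD(5)[OF f] and fnn = siccD(6)[OF f] and \<psi>pos = siccD(8)[OF f]
  have \<psi>K: "\<psi> (inverse K) > 0" using K1 by (intro \<psi>pos) (auto simp: inverse_le_1_iff)
  have X0: "x \<in> space M \<Longrightarrow> 0 \<le> X n x" and iX: "integrable M (X n)" for n x
    using X(2) by (auto simp: nonneg_integrable_seq_def)
  have ifX: "integrable M (\<lambda>x. f (X n x))" for n
    using iX X0 by (rule integrable_concave_mono[OF fconc f0 fmono fcont]) auto
  have G: "\<exists>G. supermartingale_upto N G \<and>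
      (\<forall>n. \<forall>x\<in>space M. \<psi> (inverse K) * f (X n x) \<le> G n x) \<and>
      expectation (G 0) \<le> expectation (\<lambda>x. f (X 0 x)) + f t" for N
  proof -
    obtain G where "supermartingale_upto N G"
      and "\<And>n x. x \<in> space M \<Longrightarrow> \<psi> (inverse K) * f (X n x) \<le> G n x"
      and "expectation (G 0) \<le> expectation (\<lambda>x. f (X 0 x)) + f t"
      by (rule almost_supermartingale_concave_majorant[OF X C a K step f t, of N]) (rule that)
    then show ?thesis by blast
  qed
  show "\<psi> (inverse K) * expectation (\<lambda>x. f (X N x)) \<le> expectation (\<lambda>x. f (X 0 x)) + f t"
  proof -
    obtain G where G: "supermartingale_upto N G"
      "\<And>n x. x \<in> space M \<Longrightarrow> \<psi> (inverse K) * f (X n x) \<le> G n x"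
      "expectation (G 0) \<le> expectation (\<lambda>x. f (X 0 x)) + f t" using G[of N] by blast
    have "\<psi> (inverse K) * expectation (\<lambda>x. f (X N x)) = expectation (\<lambda>x. \<psi> (inverse K) * f (X N x))"
      by simp
    also have "\<dots> \<le> expectation (G N)"
      using ifX G by (intro integral_mono) (auto simp: supermartingale_upto_def)
    also have "\<dots> \<le> expectation (G 0)" by (rule supermartingale_upto_expectation_le[OF G(1)])
    finally show ?thesis using G(3) by simp
  qed
  show "\<psi> (inverse K) * f \<delta> * prob {x \<in> space M. \<exists>n. \<delta> \<le> X n x}
      \<le> expectation (\<lambda>x. f (X 0 x)) + f t" if \<delta>: "\<delta> \<ge> 0"
  proof -
    have [measurable]: "X n \<in> borel_measurable M" for n using iX by auto
    let ?c = "\<psi> (inverse K) * f \<delta>"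
    let ?B = "\<lambda>N. {x \<in> space M. \<exists>n\<le>N. \<delta> \<le> X n x}"
    have c: "0 \<le> ?c" using \<psi>K fnn[OF \<delta>] by simp
    have fin: "?c * prob (?B N) \<le> expectation (\<lambda>x. f (X 0 x)) + f t" for N
    proof -
      obtain G where G: "supermartingale_upto N G"
        "\<And>n x. x \<in> space M \<Longrightarrow> \<psi> (inverse K) * f (X n x) \<le> G n x"
        "expectation (G 0) \<le> expectation (\<lambda>x. f (X 0 x)) + f t" using G[of N] by blast
      have G0: "0 \<le> G n x" if "x \<in> space M" for n x
        using G(2)[OF that, of n] \<psi>K fnn[OF X0[OF that, of n]] mult_nonneg_nonneg[of "\<psi> (inverse K)" "f (X n x)"]
        by linarith
      have [measurable]: "G n \<in> borel_measurable M" if "n \<le> N" for n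
        using G(1) that by (auto simp: supermartingale_upto_def)
      \<comment> \<open>By monotonicity of \<open>f\<close>, once \<open>X n\<close> reaches
        \<open>\<delta>\<close> the majorant \<open>G n\<close> has reached
        \<open>?c\<close>.\<close>
      have "prob (?B N) \<le> prob {x \<in> space M. \<exists>n\<le>N. ?c \<le> G n x}"
      proof (rule finite_measure_mono)
        show "?B N \<subseteq> {x \<in> space M. \<exists>n\<le>N. ?c \<le> G n x}"
        proof clarify
          fix x n assume x: "x \<in> space M" and n: "n \<le> N" "\<delta> \<le> X n x"
          have "f \<delta> \<le> f (X n x)" using n \<delta> by (intro mono_onD[OF fmono]) auto
          then have "?c \<le> \<psi> (inverse K) * f (X n x)" using \<psi>K by simp
          then show "\<exists>n\<le>N. ?c \<le> G n x" using G(2)[OF x, of n] n(1) by (meson order_trans)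
        qed
        have "{x \<in> space M. \<exists>n\<le>N. ?c \<le> G n x} = (\<Union>n\<le>N. {x \<in> space M. ?c \<le> G n x})" by auto
        also have "\<dots> \<in> sets M" by (intro sets.finite_UN) auto
        finally show "{x \<in> space M. \<exists>n\<le>N. ?c \<le> G n x} \<in> sets M" .
      qed
      then have "?c * prob (?B N) \<le> ?c * prob {x \<in> space M. \<exists>n\<le>N. ?c \<le> G n x}"
        using c by (rule mult_left_mono)
      also have "\<dots> \<le> expectation (G 0)"
        using G0 by (intro supermartingale_upto_maximal_ineq G)
      finally show ?thesis using G(3) by simp
    qed
    \<comment> \<open>The events \<open>?B N\<close> increase to the event without horizon, so
      continuity from below carries the uniform bound over.\<close>
    have "(\<lambda>N. prob (?B N)) \<longlonglongrightarrow> prob (\<Union>N. ?B N)"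
    proof (rule finite_Lim_measure_incseq)
      show "range ?B \<subseteq> sets M" by auto
      show "incseq ?B" by (auto simp: incseq_def intro: order_trans)
    qed
    also have "(\<Union>N. ?B N) = {x \<in> space M. \<exists>n. \<delta> \<le> X n x}" by auto
    finally have "(\<lambda>N. ?c * prob (?B N)) \<longlonglongrightarrow> ?c * prob {x \<in> space M. \<exists>n. \<delta> \<le> X n x}"
      by (rule tendsto_mult_left)
    then show ?thesis by (rule LIMSEQ_le_const2) (use fin in blast)
  qed
qed

end

section \<open>From the recursion to the two rates\<close>

theorem theorem3p4:
  fixes P :: "'a measure" and F :: "nat \<Rightarrow> 'a measure"
    and X V C :: "nat \<Rightarrow> 'a \<Rightarrow> real" and a u :: "nat \<Rightarrow> real"
    and K L M :: real
    and chi :: "real \<Rightarrow> nat" and \<theta> :: "nat \<Rightarrow> real \<Rightarrow> nat"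
    and \<tau> f \<psi> \<kappa> :: "real \<Rightarrow> real"
    and \<epsilon>' :: "real \<Rightarrow> real" and \<rho> :: "real \<Rightarrow> nat"
  defines "\<epsilon>' \<equiv> \<lambda>\<epsilon>. \<epsilon> * \<psi> (inverse K) / 2"
    and "\<rho> \<equiv> \<lambda>\<epsilon>. \<theta> (chi (\<kappa> (\<epsilon>' \<epsilon>))) (K * (L + M) / \<tau> (\<epsilon>' \<epsilon>))"
  assumes "prob_space P"
    and "filtration (space P) F" and "\<And>n. subalgebra P (F n)"
    and "adapted F X" and "adapted F V" and "adapted F C"
    and "nonneg_integrable_seq P X" and "nonneg_integrable_seq P V" and "nonneg_integrable_seq P C"
    and "\<And>n. a n \<ge> 0" and "\<And>n. u n \<ge> 0"
    and "\<And>n. AE \<omega> in P. real_cond_exp P (F n) (X (Suc n)) \<omega>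
                          \<le> (1 + a n) * X n \<omega> - u n * V n \<omega> + C n \<omega>"
    and "K > 0" and "L > 0" and "M > 0"
    and "(\<integral>\<omega>. X 0 \<omega> \<partial>P) < L"
    and "convergent_prod (\<lambda>i. 1 + a i)" and "(\<Prod>i. 1 + a i) < K"
    and "summable (\<lambda>i. \<integral>\<omega>. C i \<omega> \<partial>P)" and "(\<Sum>i. \<integral>\<omega>. C i \<omega> \<partial>P) < M"
    and "\<And>k b. b > 0 \<Longrightarrow> (\<Sum>i=k..\<theta> k b. u i) \<ge> b"
    and "\<And>\<epsilon>. \<epsilon> > 0 \<Longrightarrow> (\<Sum>i. \<integral>\<omega>. C (chi \<epsilon> + i) \<omega> \<partial>P) < \<epsilon>"
    and "sicc f \<psi> \<kappa>"
    and "\<And>\<epsilon>. \<epsilon> > 0 \<Longrightarrow> \<tau> \<epsilon> > 0"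
    and "\<And>\<epsilon> n. \<epsilon> > 0 \<Longrightarrow> (\<integral>\<omega>. V n \<omega> \<partial>P) < \<tau> \<epsilon> \<Longrightarrow> (\<integral>\<omega>. f (X n \<omega>) \<partial>P) < \<epsilon>"
  shows "mean_zero_rate P (\<lambda>n \<omega>. f (X n \<omega>)) \<rho> \<and>
         as_zero_rate P X (\<lambda>l \<epsilon>. \<rho> (l * f \<epsilon>))"
proof -
  note filt = assms(4) and sub = assms(5) and X_ad = assms(6) and C_ad = assms(8)
    and X_ni = assms(9) and V_ni = assms(10) and C_ni = assms(11)
    and a_nn = assms(12) and u_nn = assms(13) and step = assms(14)
    and K = assms(15) and L = assms(16) and M = assms(17) and X0L = assms(18)
    and cprod = assms(19) and prodK = assms(20) and C_sum = assms(21) and C_M = assms(22)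
    and \<theta> = assms(23) and chi = assms(24) and f = assms(25) and \<tau> = assms(26) and V\<tau> = assms(27)
  interpret prob_space P by (rule assms(3))
  interpret filt: filtration "space P" F by (rule filt)
  interpret filtered_prob_space P F
    by unfold_locales (use sub filt.space_F filt.sets_F_mono in \<open>auto simp: subalgebra_def\<close>)
  have iX: "integrable P (X n)" and X0: "x \<in> space P \<Longrightarrow> 0 \<le> X n x"
    and iV: "integrable P (V n)" and V0: "x \<in> space P \<Longrightarrow> 0 \<le> V n x"
    and iC: "integrable P (C n)" and C0: "x \<in> space P \<Longrightarrow> 0 \<le> C n x" for n x
    using X_ni V_ni C_ni by (auto simp: nonneg_integrable_seq_def)
  have EX0: "0 \<le> expectation (X n)" and EV0: "0 \<le> expectation (V n)" and EC0: "0 \<le> expectation (C n)" for n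
    using X0 V0 C0 by (auto intro: Bochner_Integration.integral_nonneg)
  note fconc = siccD(1)[OF f] and fcont = siccD(2)[OF f] and f0 = siccD(3)[OF f]
    and fsm = siccD(4)[OF f] and fmono = siccD(5)[OF f] and \<psi>pos = siccD(8)[OF f]
    and \<kappa>pos = siccD(9)[OF f] and \<kappa> = siccD(10)[OF f]
  have prod_le: "(\<Prod>i<n. 1 + a i) \<le> (\<Prod>i. 1 + a i)" for n
    using cprod a_nn by (intro prod_le_prodinf[OF convergent_prod_has_prod]) (auto simp: add_nonneg_nonneg)
  have prod_ge1: "1 \<le> (\<Prod>i<n. 1 + a i)" for n using a_nn by (intro prod_ge_1) simp
  \<comment> \<open>The empty product already gives \<open>1 < K\<close>, so
    \<open>inverse K\<close> lies in \<open>{0<..1}\<close>, where \<open>\<psi>\<close> is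
    positive.\<close>
  have K1: "1 < K" using prod_le[of 0] prodK by simp
  have \<psi>K: "\<psi> (inverse K) > 0" using K1 by (intro \<psi>pos) (auto simp: inverse_le_1_iff)
  have ifX: "integrable P (\<lambda>x. f (X n x))" for n
    using iX X0 by (rule integrable_concave_mono[OF fconc f0 fmono fcont]) auto

  have mean_step: "expectation (X (Suc n)) \<le> (1 + a n) * expectation (X n) - u n * expectation (V n) + expectation (C n)" for n
  proof -
    interpret sigma_finite_subalgebra P "F n" by (rule sigma_finite_subalgebra_F)
    have "expectation (X (Suc n)) = expectation (real_cond_exp P (F n) (X (Suc n)))"
      using iX by (simp add: real_cond_exp_int)
    also have "\<dots> \<le> expectation (\<lambda>x. (1 + a n) * X n x - u n * V n x + C n x)"
      using step[of n] iX iV iC by (intro integral_mono_AE real_cond_exp_int) auto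
    also have "\<dots> = (1 + a n) * expectation (X n) - u n * expectation (V n) + expectation (C n)"
      using iX iV iC by simp
    finally show ?thesis .
  qed
  have uV: "(\<Sum>i<n. u i * expectation (V i)) < K * (L + M)" for n
  proof -
    have "(\<Sum>i<n. u i * expectation (V i)) \<le> expectation (X n) + (\<Sum>i<n. u i * expectation (V i))"
      using EX0 by simp
    also have "\<dots> \<le> (\<Prod>i<n. 1 + a i) * (expectation (X 0) + (\<Sum>i<n. expectation (C i)))"
      using mean_step a_nn u_nn EV0 EC0 by (rule summed_gronwall_with_loss)
    also have "\<dots> \<le> K * (expectation (X 0) + (\<Sum>i<n. expectation (C i)))"
      using prod_le[of n] prodK EX0 EC0 by (intro mult_right_mono) (auto intro!: add_nonneg_nonneg sum_nonneg)
    also have "(\<Sum>i<n. expectation (C i)) \<le> (\<Sum>i. expectation (C i))"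
      using C_sum EC0 by (intro sum_le_suminf) auto
    then have "K * (expectation (X 0) + (\<Sum>i<n. expectation (C i))) < K * (L + M)"
      using K X0L C_M by (intro mult_strict_left_mono) auto
    finally show ?thesis .
  qed

  \<comment> \<open>Both rates are read off from one time \<open>m\<close>, not later than
    \<open>\<rho> \<epsilon>\<close>, and one number \<open>s\<close> that bounds all later means
    and the exceedance probabilities alike.\<close>
  have main: "\<exists>m s. m \<le> \<rho> \<epsilon> \<and> s < \<epsilon> * \<psi> (inverse K) \<and>
      (\<forall>n. \<psi> (inverse K) * expectation (\<lambda>x. f (X (m + n) x)) \<le> s) \<and>
      (\<forall>\<delta>\<ge>0. \<psi> (inverse K) * f \<delta> * prob {x \<in> space P. \<exists>n. \<delta> \<le> X (m + n) x} \<le> s)"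
    if \<epsilon>: "\<epsilon> > 0" for \<epsilon>
  proof -
    define e where "e = \<epsilon>' \<epsilon>"
    have e: "e > 0" using \<epsilon> \<psi>K by (simp add: e_def \<epsilon>'_def)
    define k where "k = chi (\<kappa> e)"
    define b where "b = K * (L + M) / \<tau> e"
    have b: "b > 0" using K L M \<tau>[OF e] by (simp add: b_def)
    have \<rho>: "\<rho> \<epsilon> = \<theta> k b" by (simp add: \<rho>_def e_def k_def b_def)
    \<comment> \<open>If no such \<open>m\<close> existed, the window from \<open>k\<close> to
      \<open>\<rho> \<epsilon>\<close> alone would contribute at least
      \<open>b * \<tau> e = K * (L + M)\<close> to the weighted sum of the means of
      \<open>V\<close>, against the strict bound \<open>uV\<close>. The window includes its right
      end, hence the partial sum up to \<open>Suc (\<rho> \<epsilon>)\<close>.\<close>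
    obtain m where m: "k \<le> m" "m \<le> \<rho> \<epsilon>" "expectation (V m) < \<tau> e"
    proof (rule ccontr)
      assume "\<not> thesis"
      then have V: "\<tau> e \<le> expectation (V i)" if "i \<in> {k..\<rho> \<epsilon>}" for i
        using that \<open>\<And>m. \<lbrakk>k \<le> m; m \<le> \<rho> \<epsilon>; expectation (V m) < \<tau> e\<rbrakk> \<Longrightarrow> thesis\<close> by force
      have "K * (L + M) = b * \<tau> e" using \<tau>[OF e] by (simp add: b_def)
      also have "\<dots> \<le> (\<Sum>i=k..\<rho> \<epsilon>. u i) * \<tau> e"
        using \<theta>[OF b, of k] \<tau>[OF e] by (intro mult_right_mono) (auto simp: \<rho>)
      also have "\<dots> \<le> (\<Sum>i=k..\<rho> \<epsilon>. u i * expectation (V i))"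
        unfolding sum_distrib_right using V u_nn by (intro sum_mono mult_left_mono) auto
      also have "\<dots> \<le> (\<Sum>i<Suc (\<rho> \<epsilon>). u i * expectation (V i))"
        using u_nn EV0 by (intro sum_mono2) auto
      also have "\<dots> < K * (L + M)" by (rule uV)
      finally show False by simp
    qed
    define T where "T = (\<Sum>i. expectation (C (k + i)))"
    have T: "T < \<kappa> e" unfolding T_def k_def using chi[OF \<kappa>pos[OF e]] by simp
    have sumk: "summable (\<lambda>i. expectation (C (k + i)))"
      using summable_ignore_initial_segment[OF C_sum, of k] by (simp add: add.commute)
    have T0: "0 \<le> T" unfolding T_def using sumk EC0 by (intro suminf_nonneg) auto
    \<comment> \<open>The midpoint lies strictly above the tail sum \<open>T\<close>, as the bounds
      for almost supermartingales require, and still below \<open>\<kappa> e\<close>, which gives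
      \<open>f t < e\<close>.\<close>
    define t where "t = (T + \<kappa> e) / 2"
    have t: "T < t" "t < \<kappa> e" using T by (auto simp: t_def)
    have ft: "f t < e" using t T0 e by (intro \<kappa>) auto
    have fXm: "expectation (\<lambda>x. f (X m x)) < e" by (rule V\<tau>[OF e m(3)])
    define s where "s = expectation (\<lambda>x. f (X m x)) + f t"
    \<comment> \<open>Both summands of \<open>s\<close> are below \<open>e\<close>, and
      \<open>2 * e = \<epsilon> * \<psi> (inverse K)\<close>; this explains the factor 2 in the
      definition of \<open>\<epsilon>'\<close>.\<close>
    have s: "s < \<epsilon> * \<psi> (inverse K)"
      using ft fXm by (simp add: s_def e_def \<epsilon>'_def)
    interpret shift: filtered_prob_space P "\<lambda>n. F (m + n)"
      by unfold_locales (use subalgebra_M subalgebra_F in auto)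
    have Cm: "(\<Sum>i<N. expectation (C (m + i))) < t" for N
    proof -
      \<comment> \<open>As \<open>k \<le> m\<close>, the sum is a block of the nonnegative series
        that starts at \<open>k\<close>.\<close>
      have "(\<Sum>i<N. expectation (C (m + i))) = (\<Sum>i\<in>{m - k..<m - k + N}. expectation (C (k + i)))"
        using m(1) by (intro sum.reindex_bij_witness[of _ "\<lambda>i. i - (m - k)" "\<lambda>i. i + (m - k)"])
             (auto simp: add.commute)
      also have "\<dots> \<le> T"
        unfolding T_def using sumk EC0 by (intro sum_le_suminf) auto
      finally show ?thesis using t(1) by simp
    qed
    have prodm: "(\<Prod>i<n. 1 + a (m + i)) \<le> K" for n
    proof -
      \<comment> \<open>Putting back the first \<open>m\<close> factors, each at least 1, only
        enlarges the product.\<close>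
      have "1 * (\<Prod>i<n. 1 + a (m + i)) \<le> (\<Prod>i<m. 1 + a i) * (\<Prod>i<n. 1 + a (m + i))"
        using prod_ge1[of m] a_nn by (intro mult_right_mono prod_nonneg) (auto simp: add_nonneg_nonneg)
      also have "\<dots> = (\<Prod>i<m + n. 1 + a i)" by (induction n) (simp_all add: ac_simps)
      finally show ?thesis using prod_le[of "m + n"] prodK by simp
    qed
    \<comment> \<open>The loss term has served to find \<open>m\<close>; from here on it is dropped
      by its sign.\<close>
    have stepm: "AE x in P. real_cond_exp P (F (m + n)) (X (m + Suc n)) x
        \<le> (1 + a (m + n)) * X (m + n) x + C (m + n) x" for n
      using step[of "m + n"] AE_space[of P]
    proof eventually_elim
      case (elim x)
      then show ?case using mult_nonneg_nonneg[OF u_nn[of "m + n"] V0[of x "m + n"]] by simp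
    qed
    have ad: "adapted (\<lambda>n. F (m + n)) (\<lambda>n. X (m + n))" "adapted (\<lambda>n. F (m + n)) (\<lambda>n. C (m + n))"
      and ni: "nonneg_integrable_seq P (\<lambda>n. X (m + n))" "nonneg_integrable_seq P (\<lambda>n. C (m + n))"
      using X_ad C_ad X_ni C_ni by (auto simp: adapted_def nonneg_integrable_seq_def)
    note bounds = shift.almost_supermartingale_bounds[OF ad(1) ni(1) ad(2) ni(2) a_nn prodm stepm f Cm]
    show ?thesis
    proof (intro exI conjI allI impI)
      show "\<psi> (inverse K) * expectation (\<lambda>x. f (X (m + n) x)) \<le> s" for n
        using bounds(1)[of n] by (simp add: s_def)
      show "\<psi> (inverse K) * f \<delta> * prob {x \<in> space P. \<exists>n. \<delta> \<le> X (m + n) x} \<le> s" if "0 \<le> \<delta>" for \<delta>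
        using bounds(2)[OF that] by (simp add: s_def)
    qed (use m(2) s in auto)
  qed
  show ?thesis
  proof
    show "mean_zero_rate P (\<lambda>n \<omega>. f (X n \<omega>)) \<rho>"
      unfolding mean_zero_rate_def
    proof (intro allI impI conjI)
      fix \<epsilon> :: real and n assume \<epsilon>: "0 < \<epsilon>" and n: "\<rho> \<epsilon> \<le> n"
      obtain m s where ms: "m \<le> \<rho> \<epsilon>" "s < \<epsilon> * \<psi> (inverse K)"
        "\<And>n. \<psi> (inverse K) * expectation (\<lambda>x. f (X (m + n) x)) \<le> s"
        using main[OF \<epsilon>] by blast
      have "expectation (\<lambda>x. f (X n x)) * \<psi> (inverse K) < \<epsilon> * \<psi> (inverse K)"
        using ms(2) ms(3)[of "n - m"] ms(1) n by (simp add: mult.commute)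
      then show "expectation (\<lambda>x. f (X n x)) < \<epsilon>" using \<psi>K by simp
    qed (rule ifX)
    show "as_zero_rate P X (\<lambda>l \<epsilon>. \<rho> (l * f \<epsilon>))"
      unfolding as_zero_rate_def
    proof (intro allI impI)
      fix l \<delta> :: real assume l: "0 < l" and \<delta>: "0 < \<delta>"
      have f\<delta>: "0 < f \<delta>" using strict_mono_onD[OF fsm, of 0 \<delta>] f0 \<delta> by simp
      \<comment> \<open>With \<open>l * f \<delta>\<close> in place of \<open>\<epsilon>\<close>,
        the bound on \<open>s\<close> is \<open>l\<close> times the factor in front of the
        probability, so dividing by that factor leaves \<open>l\<close>.\<close>
      obtain m s where ms: "m \<le> \<rho> (l * f \<delta>)" "s < (l * f \<delta>) * \<psi> (inverse K)"
        "\<And>\<delta>. \<delta> \<ge> 0 \<Longrightarrow> \<psi> (inverse K) * f \<delta> * prob {x \<in> space P. \<exists>n. \<delta> \<le> X (m + n) x} \<le> s"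
        using main[OF mult_pos_pos[OF l f\<delta>]] by blast
      have [measurable]: "X n \<in> borel_measurable P" for n using iX by auto
      have "prob {x \<in> space P. \<exists>n\<ge>\<rho> (l * f \<delta>). \<delta> \<le> X n x} \<le> prob {x \<in> space P. \<exists>n. \<delta> \<le> X (m + n) x}"
      proof (rule finite_measure_mono)
        show "{x \<in> space P. \<exists>n\<ge>\<rho> (l * f \<delta>). \<delta> \<le> X n x} \<subseteq> {x \<in> space P. \<exists>n. \<delta> \<le> X (m + n) x}"
        proof clarify
          fix x n assume "\<rho> (l * f \<delta>) \<le> n" "\<delta> \<le> X n x"
          then show "\<exists>n. \<delta> \<le> X (m + n) x" using ms(1) by (intro exI[of _ "n - m"]) simp
        qed
        show "{x \<in> space P. \<exists>n. \<delta> \<le> X (m + n) x} \<in> sets P" by measurable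
      qed
      moreover have "(\<psi> (inverse K) * f \<delta>) * prob {x \<in> space P. \<exists>n. \<delta> \<le> X (m + n) x} < (\<psi> (inverse K) * f \<delta>) * l"
        using ms(2) ms(3)[of \<delta>] \<delta> by (simp add: ac_simps)
      then have "prob {x \<in> space P. \<exists>n. \<delta> \<le> X (m + n) x} < l"
        using \<psi>K f\<delta> by (simp add: mult_less_cancel_left_pos)
      ultimately show "prob {x \<in> space P. \<exists>n\<ge>\<rho> (l * f \<delta>). \<delta> \<le> X n x} < l" by simp
    qed
  qed
qed

end
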